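(* Let $R$ be an Artinian commutative ring with identity such that the weakly zero-divisor graph $W\Gamma(R)$ is non-empty. Then $\kappa(W\Gamma(R))=\delta(W\Gamma(R))$.
   Context: Weakly zero-divisor graph: for a commutative ring $R$ with identity, $Z(R)$ is the set of zero-divisors (elements $x$ with $xy=0$ for some $y\ne 0$), $Z(R)^*=Z(R)\setminus\{0\}$, and $\mathrm{ann}(x)=\{r\in R: rx=0\}$. $W\Gamma(R)$ is the simple undirected graph with vertex set $Z(R)^*$ in which two distinct vertices $x,y$ are adjacent if and only if there exist nonzero $w\in\mathrm{ann}(x)$ and nonzero $z\in\mathrm{ann}(y)$ with $wz=0$. Graph notions: a cut-set of a connected graph $\Gamma$ is a set $A\subseteq V(\Gamma)$ such that there are distinct vertices $x,y\in V(\Gamma)\setminus A$ with every path from $x$ to $y$ meeting $A$, and no proper subset of $A$ has this property. For a connected graph that is not complete, $\kappa(\Gamma)$ (vertex connectivity) is the smallest cardinality of a cut-set; for a complete graph, which has no cut-set, the usual convention $\kappa(\Gamma)=|V(\Gamma)|-1$ is used (read as $|V(\Gamma)|$ if $V(\Gamma)$ is infinite). $\deg(v)$ is the cardinality of the set of neighbours of $v$, and $\delta(\Gamma)=\min\{\deg(v): v\in V(\Gamma)\}$. *)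

theory Defs
  imports "HOL-Algebra.Ring_Divisibility" "Graph_Theory.Pair_Digraph" "Graph_Theory.Vertex_Walk"
begin

unbundle cardinal_syntax

(* frees the symbol for addition in a ring *)
no_notation vwalk_join (infixr \<open>\<oplus>\<close> 65)


section \<open>Cardinals\<close>

text \<open>
  Vertex sets may be infinite, so degrees and connectivities are cardinals in the sense of
  \<^const>\<open>card_of\<close>; two of them are compared by \<^const>\<open>ordIso2\<close>, not by equality of relations.
  For \<open>\<A> = {}\<close> the value of \<open>least_card \<A>\<close> is unspecified.
\<close>

definition least_card :: "'a set set \<Rightarrow> 'a rel" where
  "least_card \<A> = |SOME A. A \<in> \<A> \<and> (\<forall>B\<in>\<A>. |A| \<le>o |B| )|"

lemma least_card:
  assumes "\<A> \<noteq> {}"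
  shows "\<exists>A\<in>\<A>. least_card \<A> = |A| \<and> (\<forall>B\<in>\<A>. |A| \<le>o |B| )"
proof -
  have "\<exists>r\<in>card_of ` \<A>. \<forall>r'\<in>card_of ` \<A>. r \<le>o r'"
    by (rule exists_minim_Card_order) (use assms in \<open>auto simp: card_of_Card_order\<close>)
  then have "\<exists>A. A \<in> \<A> \<and> (\<forall>B\<in>\<A>. |A| \<le>o |B| )"
    by blast
  from someI_ex[OF this] show ?thesis
    unfolding least_card_def by blast
qed

lemma least_card_ordIso:
  assumes "A \<in> \<A>" and "\<And>B. B \<in> \<A> \<Longrightarrow> |A| \<le>o |B|"
  shows "least_card \<A> =o |A|"
proof -
  obtain A' where "A' \<in> \<A>" "least_card \<A> = |A'|" "\<forall>B\<in>\<A>. |A'| \<le>o |B|"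
    using least_card[of \<A>] assms(1) by blast
  then show ?thesis
    using assms by (simp add: ordIso_iff_ordLeq)
qed


section \<open>Connectivity and minimum degree\<close>

text \<open>
  A simple undirected graph is a symmetric loop-free \<^typ>\<open>'a pair_pre_digraph\<close>
  (locale \<^locale>\<open>pair_bidirected_digraph\<close>), an edge being the two arcs between its ends.
\<close>

definition separating_set :: "'a pair_pre_digraph \<Rightarrow> 'a set \<Rightarrow> bool" where
  "separating_set G A \<longleftrightarrow> A \<subseteq> pverts G \<and>
     (\<exists>x\<in>pverts G - A. \<exists>y\<in>pverts G - A. x \<noteq> y \<and>
        (\<forall>p. vpath p (with_proj G) \<and> hd p = x \<and> last p = y \<longrightarrow> set p \<inter> A \<noteq> {}))"

definition cut_set :: "'a pair_pre_digraph \<Rightarrow> 'a set \<Rightarrow> bool" where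
  "cut_set G A \<longleftrightarrow> separating_set G A \<and> (\<forall>B. B \<subset> A \<longrightarrow> \<not> separating_set G B)"

definition complete_graph :: "'a pair_pre_digraph \<Rightarrow> bool" where
  "complete_graph G \<longleftrightarrow> (\<forall>x\<in>pverts G. \<forall>y\<in>pverts G. x \<noteq> y \<longrightarrow> (x, y) \<in> parcs G)"

text \<open>
  In the complete case, removing one vertex from the vertex set \<open>V\<close> yields the cardinal \<open>|V| - 1\<close>
  if \<open>V\<close> is finite and nonempty, and \<open>|V|\<close> if \<open>V\<close> is infinite.
\<close>

definition vertex_connectivity :: "'a pair_pre_digraph \<Rightarrow> 'a rel" where
  "vertex_connectivity G =
     (if complete_graph G then |pverts G - {SOME v. v \<in> pverts G}|
      else least_card {A. cut_set G A})"

definition neighbours :: "'a pair_pre_digraph \<Rightarrow> 'a \<Rightarrow> 'a set" where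
  "neighbours G v = {u. (v, u) \<in> parcs G}"

definition min_degree :: "'a pair_pre_digraph \<Rightarrow> 'a rel" where
  "min_degree G = least_card (neighbours G ` pverts G)"


section \<open>Artinian rings and the weakly zero-divisor graph\<close>

locale artinian_cring = cring +
  assumes descending_chain:
    "\<lbrakk>\<And>n::nat. ideal (I n) R; \<And>n. I (Suc n) \<subseteq> I n\<rbrakk> \<Longrightarrow> \<exists>N. \<forall>n\<ge>N. I n = I N"

definition zero_divisors :: "('a, 'm) ring_scheme \<Rightarrow> 'a set" where
  "zero_divisors R = {x \<in> carrier R. \<exists>y\<in>carrier R. y \<noteq> \<zero>\<^bsub>R\<^esub> \<and> x \<otimes>\<^bsub>R\<^esub> y = \<zero>\<^bsub>R\<^esub>}"

definition annihilator :: "('a, 'm) ring_scheme \<Rightarrow> 'a \<Rightarrow> 'a set" where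
  "annihilator R x = {r \<in> carrier R. r \<otimes>\<^bsub>R\<^esub> x = \<zero>\<^bsub>R\<^esub>}"

definition weakly_zero_divisor_graph :: "('a, 'm) ring_scheme \<Rightarrow> 'a pair_pre_digraph" where
  "weakly_zero_divisor_graph R =
     (let V = zero_divisors R - {\<zero>\<^bsub>R\<^esub>} in
      \<lparr>pverts = V,
       parcs = {(x, y). x \<in> V \<and> y \<in> V \<and> x \<noteq> y \<and>
         (\<exists>w\<in>annihilator R x. \<exists>z\<in>annihilator R y.
            w \<noteq> \<zero>\<^bsub>R\<^esub> \<and> z \<noteq> \<zero>\<^bsub>R\<^esub> \<and> w \<otimes>\<^bsub>R\<^esub> z = \<zero>\<^bsub>R\<^esub>)}\<rparr>)"

lemma (in cring) pair_bidirected_digraph_weakly_zero_divisor_graph: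
  "pair_bidirected_digraph (weakly_zero_divisor_graph R)"
proof
  show "symmetric (with_proj (weakly_zero_divisor_graph R))"
    by (auto simp: symmetric_def sym_def weakly_zero_divisor_graph_def Let_def annihilator_def)
       (metis m_comm)
qed (auto simp: weakly_zero_divisor_graph_def Let_def)

end

theory Submission
  imports Defs
begin

text \<open>
  The graph is complete multipartite: being equal or non-adjacent is an equivalence relation on its
  vertices. For any complete multipartite graph, finite or not, connectivity and minimum degree agree.

  That \<open>W\<Gamma>(R)\<close> is complete multipartite comes from the descending chain condition in the form of
  \<open>nonzero_multiple_annihilated\<close>: if \<open>w \<otimes> v = \<zero>\<close>, every nonzero ideal contains a nonzero element
  killed by \<open>w\<close> or by \<open>v\<close>. Let \<open>w\<close> and \<open>v\<close> witness that \<open>x\<close> and \<open>z\<close> are adjacent, and apply this to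
  the ideal \<open>ann(y)\<close>, where \<open>y\<close> is a third vertex: an element of \<open>ann(y)\<close> killed by \<open>w\<close> makes \<open>y\<close>
  adjacent to \<open>x\<close>, and one killed by \<open>v\<close> makes \<open>y\<close> adjacent to \<open>z\<close>. So \<open>y\<close> cannot be non-adjacent
  to both.

  In a complete multipartite graph the neighbours of a vertex are all the vertices outside its part.
  Two vertices can be separated only if they lie in a common part, and then every vertex outside
  this part has to be removed, which suffices. Hence the cut-sets are exactly the neighbourhoods of
  the vertices whose part is not a singleton (\<open>cut_set_iff\<close>). A vertex \<open>u\<close> whose part is a singleton
  is adjacent to all the others, so it has the greatest possible degree \<open>|V - {u}|\<close>; leaving such
  vertices out therefore does not change the minimum, unless all parts are singletons. In this last
  case the graph is complete, and all degrees equal the conventional value of \<open>\<kappa>\<close>.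
\<close>

section \<open>Vertex connectivity of complete multipartite graphs\<close>

text \<open>
  The parts are left implicit: they are the classes of the relation of being equal or non-adjacent,
  and the axiom is the transitivity of this relation in contrapositive form.
\<close>

locale complete_multipartite_graph = pair_bidirected_digraph +
  assumes arc_cotrans:
    "\<lbrakk>(x, z) \<in> parcs G; y \<in> pverts G\<rbrakk> \<Longrightarrow> (x, y) \<in> parcs G \<or> (y, z) \<in> parcs G"
begin

lemma arc_sym: "(x, y) \<in> parcs G \<Longrightarrow> (y, x) \<in> parcs G"
  using pair_sym_arcs by (auto simp: symmetric_def dest: symD)

lemma arc_irrefl: "(x, x) \<notin> parcs G"
  using pair_no_loops[of "(x, x)"] by auto

lemma neighbours_subset: "neighbours G x \<subseteq> pverts G - {x}"
  by (auto simp: neighbours_def arc_irrefl dest: in_arcsD2)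

lemma neighbours_eq_if_not_adjacent:
  assumes "x \<in> pverts G" "y \<in> pverts G" "(x, y) \<notin> parcs G"
  shows "neighbours G x = neighbours G y"
  using assms arc_cotrans arc_sym unfolding neighbours_def by blast

text \<open>
  Adjacent vertices cannot be separated. Distinct non-adjacent vertices \<open>x\<close> and \<open>y\<close> have the same
  neighbours, each of which is the middle of a path from \<open>x\<close> to \<open>y\<close> and so has to lie in \<open>A\<close>.
\<close>

lemma separating_setE:
  assumes "separating_set G A"
  obtains x y where "x \<in> pverts G - A" "y \<in> pverts G - A" "x \<noteq> y" "(x, y) \<notin> parcs G"
    "neighbours G x \<subseteq> A"
proof -
  obtain x y where xy: "x \<in> pverts G - A" "y \<in> pverts G - A" "x \<noteq> y"
    and meets: "\<And>p. \<lbrakk>vpath p (with_proj G); hd p = x; last p = y\<rbrakk> \<Longrightarrow> set p \<inter> A \<noteq> {}"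
    using assms unfolding separating_set_def by blast
  have not_adj: "(x, y) \<notin> parcs G"
  proof
    assume "(x, y) \<in> parcs G"
    then have "vpath [x, y] (with_proj G)"
      using xy by (auto simp: vpath_def vwalk_def)
    from meets[OF this] show False
      using xy by simp
  qed
  have "neighbours G x \<subseteq> A"
  proof
    fix z assume z: "z \<in> neighbours G x"
    then have "z \<in> neighbours G y"
      using neighbours_eq_if_not_adjacent[OF _ _ not_adj] xy by blast
    with z have arcs: "(x, z) \<in> parcs G" "(z, y) \<in> parcs G"
      by (auto simp: neighbours_def intro: arc_sym)
    then have "vpath [x, z, y] (with_proj G)"
      using xy by (auto simp: vpath_def vwalk_def arc_irrefl dest: in_arcsD2)
    from meets[OF this] show "z \<in> A"
      using xy by simp
  qed
  with xy not_adj show thesis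
    using that by blast
qed

lemma separating_set_neighbours:
  assumes "x \<in> pverts G" "y \<in> pverts G" "x \<noteq> y" "(x, y) \<notin> parcs G"
  shows "separating_set G (neighbours G x)"
proof -
  have "set p \<inter> neighbours G x \<noteq> {}"
    if p: "vpath p (with_proj G)" "hd p = x" "last p = y" for p
  proof -
    \<comment> \<open>The second vertex of the path is a neighbour of \<open>x\<close>.\<close>
    obtain q where q: "p = x # q"
      using p by (cases p) (auto simp: vpath_def vwalk_def)
    moreover obtain z q' where "q = z # q'"
      using p q \<open>x \<noteq> y\<close> by (cases q) auto
    ultimately have "z \<in> set p" "(x, z) \<in> parcs G"
      using p by (auto simp: vpath_def vwalk_def)
    then show ?thesis
      by (auto simp: neighbours_def)
  qed
  moreover have "x \<in> pverts G - neighbours G x" "y \<in> pverts G - neighbours G x"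
    using assms by (auto simp: neighbours_def arc_irrefl)
  moreover have "neighbours G x \<subseteq> pverts G"
    using neighbours_subset by blast
  ultimately show ?thesis
    unfolding separating_set_def using \<open>x \<noteq> y\<close> by blast
qed

text \<open>
  Neighbourhoods are complements of parts, so no neighbourhood contains another one properly. This
  gives minimality.
\<close>

lemma cut_set_iff:
  "cut_set G A \<longleftrightarrow>
     (\<exists>x\<in>pverts G. \<exists>y\<in>pverts G. x \<noteq> y \<and> (x, y) \<notin> parcs G \<and> A = neighbours G x)"
proof
  assume cut: "cut_set G A"
  then have "separating_set G A"
    by (simp add: cut_set_def)
  then obtain x y where xy: "x \<in> pverts G" "y \<in> pverts G" "x \<noteq> y" "(x, y) \<notin> parcs G"
    and sub: "neighbours G x \<subseteq> A"
    by (rule separating_setE) blast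
  then have "A = neighbours G x"
    using cut separating_set_neighbours[OF xy] unfolding cut_set_def by blast
  with xy show "\<exists>x\<in>pverts G. \<exists>y\<in>pverts G. x \<noteq> y \<and> (x, y) \<notin> parcs G \<and> A = neighbours G x"
    by blast
next
  assume "\<exists>x\<in>pverts G. \<exists>y\<in>pverts G. x \<noteq> y \<and> (x, y) \<notin> parcs G \<and> A = neighbours G x"
  then obtain x y where xy: "x \<in> pverts G" "y \<in> pverts G" "x \<noteq> y" "(x, y) \<notin> parcs G"
    and A: "A = neighbours G x"
    by blast
  have "\<not> separating_set G B" if B: "B \<subset> A" for B
  proof
    assume "separating_set G B"
    then obtain x' where x': "x' \<in> pverts G" "neighbours G x' \<subseteq> B"
      by (rule separating_setE) blast
    show False
    proof (cases "(x, x') \<in> parcs G")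
      case True
      then have "x \<in> neighbours G x'"
        by (simp add: neighbours_def arc_sym)
      then have "x \<in> neighbours G x"
        using x' A B by blast
      then show False
        using neighbours_subset by blast
    next
      case False
      then have "neighbours G x' = A"
        using neighbours_eq_if_not_adjacent xy(1) x'(1) A by blast
      then show False
        using x'(2) B by blast
    qed
  qed
  then show "cut_set G A"
    using separating_set_neighbours[OF xy] A unfolding cut_set_def by blast
qed

end

lemma card_of_Diff_singleton_ordIso:
  assumes "u \<in> V" "v \<in> V"
  shows "|V - {u}| =o |V - {v}|"
proof (rule card_of_ordIsoI)
  show "bij_betw (transpose u v) (V - {u}) (V - {v})"
    by (rule bij_betw_byWitness[where f' = "transpose u v"])
       (use assms in \<open>auto simp: transpose_def\<close>)
qed

theorem (in complete_multipartite_graph) vertex_connectivity_ordIso_min_degree: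
  assumes "pverts G \<noteq> {}"
  shows "vertex_connectivity G =o min_degree G"
proof -
  have dominating: "neighbours G u = pverts G - {u}"
    if "u \<in> pverts G" "\<And>v. \<lbrakk>v \<in> pverts G; u \<noteq> v\<rbrakk> \<Longrightarrow> (u, v) \<in> parcs G" for u
    using that neighbours_subset by (auto simp: neighbours_def)
  \<comment> \<open>In both cases \<open>\<kappa>\<close> is the degree of some vertex \<open>x\<close>, and it remains to compare degrees.\<close>
  have "\<exists>x\<in>pverts G. vertex_connectivity G =o |neighbours G x| \<and>
          (\<forall>u\<in>pverts G. |neighbours G x| \<le>o |neighbours G u| )"
  proof (cases "complete_graph G")
    case True
    define v where "v = (SOME v. v \<in> pverts G)"
    have v: "v \<in> pverts G"
      unfolding v_def using assms by (simp add: some_in_eq)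
    have nb: "neighbours G u = pverts G - {u}" if "u \<in> pverts G" for u
      using dominating that True unfolding complete_graph_def by blast
    have "vertex_connectivity G = |neighbours G v|"
      using True nb[OF v] by (simp add: vertex_connectivity_def v_def)
    moreover have "|neighbours G v| \<le>o |neighbours G u|" if "u \<in> pverts G" for u
      using card_of_Diff_singleton_ordIso[OF v that] nb v that by (simp add: ordIso_iff_ordLeq)
    ultimately show ?thesis
      using v card_of_refl by metis
  next
    case False
    then have "{A. cut_set G A} \<noteq> {}"
      unfolding complete_graph_def by (auto simp: cut_set_iff)
    then obtain A where A: "cut_set G A" "vertex_connectivity G = |A|"
      and least: "\<And>B. cut_set G B \<Longrightarrow> |A| \<le>o |B|"
      using least_card[of "{A. cut_set G A}"] False by (auto simp: vertex_connectivity_def)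
    from A(1) obtain x where x: "x \<in> pverts G" "A = neighbours G x"
      by (auto simp: cut_set_iff)
    have "|A| \<le>o |neighbours G u|" if u: "u \<in> pverts G" for u
    proof (cases "cut_set G (neighbours G u)")
      case True
      then show ?thesis by (rule least)
    next
      \<comment> \<open>The part of \<open>u\<close> is \<open>{u}\<close>, and no vertex has a larger degree than \<open>u\<close>.\<close>
      case False
      then have "neighbours G u = pverts G - {u}"
        using dominating u unfolding cut_set_iff by blast
      moreover have "|A| \<le>o |pverts G - {x}|"
        using x(2) neighbours_subset by (simp add: card_of_mono1)
      ultimately show ?thesis
        using ordLeq_ordIso_trans card_of_Diff_singleton_ordIso[OF x(1) u] by metis
    qed
    then show ?thesis
      using A(2) x card_of_refl by metis
  qed
  then obtain x where x: "x \<in> pverts G" "vertex_connectivity G =o |neighbours G x|"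
    and least: "\<And>u. u \<in> pverts G \<Longrightarrow> |neighbours G x| \<le>o |neighbours G u|"
    by blast
  have "min_degree G =o |neighbours G x|"
    unfolding min_degree_def by (rule least_card_ordIso) (use x(1) least in auto)
  with x(2) show ?thesis
    using ordIso_transitive ordIso_symmetric by blast
qed


section \<open>The weakly zero-divisor graph of an Artinian ring\<close>

text \<open>
  If some power of \<open>w\<close> kills \<open>t\<close>, the last nonzero \<open>w\<^sup>n t\<close> is killed by \<open>w\<close>. Otherwise all
  \<open>w\<^sup>n t\<close> are nonzero, and the descending chain of the ideals that they generate becomes
  stationary, so \<open>u = w\<^sup>n t\<close> is a multiple of \<open>w u\<close> for some \<open>n\<close>. Since \<open>v\<close> kills \<open>w\<close>, it
  kills \<open>u\<close>.
\<close>

lemma (in artinian_cring) nonzero_multiple_annihilated: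
  assumes carr: "w \<in> carrier R" "v \<in> carrier R" "t \<in> carrier R"
    and "w \<otimes> v = \<zero>" "t \<noteq> \<zero>"
  shows "\<exists>r\<in>carrier R. r \<otimes> t \<noteq> \<zero> \<and> (w \<otimes> (r \<otimes> t) = \<zero> \<or> v \<otimes> (r \<otimes> t) = \<zero>)"
proof (rule ccontr)
  assume contra: "\<not> ?thesis"
  define u where "u n = (w [^] n) \<otimes> t" for n :: nat
  have u_carr [simp]: "u n \<in> carrier R" for n
    using carr by (simp add: u_def)
  have u_Suc: "u (Suc n) = w \<otimes> u n" for n
    using carr by (simp add: u_def m_ac)
  have u_nonzero: "u n \<noteq> \<zero>" for n
  proof (induction n)
    case 0
    then show ?case using assms by (simp add: u_def)
  next
    case (Suc n)
    then show ?case
      using contra carr unfolding u_Suc by (auto simp: u_def)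
  qed
  have "PIdl (u (Suc n)) \<subseteq> PIdl (u n)" for n
  proof (rule cgenideal_minimal)
    show "u (Suc n) \<in> PIdl (u n)"
      unfolding cgenideal_def u_Suc using carr by blast
  qed (simp add: cgenideal_ideal)
  then obtain N where N: "\<And>n. n \<ge> N \<Longrightarrow> PIdl (u n) = PIdl (u N)"
    using descending_chain[of "\<lambda>n. PIdl (u n)"] cgenideal_ideal by auto
  have "u N \<in> PIdl (u (Suc N))"
    using N[of "Suc N"] cgenideal_self[of "u N"] by simp
  then obtain b where b: "b \<in> carrier R" "u N = b \<otimes> (w \<otimes> u N)"
    unfolding cgenideal_def u_Suc by blast
  have "v \<otimes> u N = v \<otimes> (b \<otimes> (w \<otimes> u N))"
    using b(2) by simp
  also have "\<dots> = b \<otimes> ((w \<otimes> v) \<otimes> u N)"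
    using b(1) carr by (simp add: m_ac)
  also have "\<dots> = \<zero>"
    using b(1) assms by simp
  finally show False
    using contra u_nonzero[of N] carr unfolding u_def by auto
qed

lemma (in artinian_cring) complete_multipartite_weakly_zero_divisor_graph:
  "complete_multipartite_graph (weakly_zero_divisor_graph R)"
proof -
  let ?G = "weakly_zero_divisor_graph R"
  interpret pair_bidirected_digraph ?G
    by (rule pair_bidirected_digraph_weakly_zero_divisor_graph)
  show ?thesis
  proof
    fix x y z
    assume xz: "(x, z) \<in> parcs ?G" and y: "y \<in> pverts ?G"
    then have vertices: "x \<in> pverts ?G" "z \<in> pverts ?G"
      by (auto dest: in_arcsD1 in_arcsD2)
    have arcI: "(p, q) \<in> parcs ?G"
      if "p \<in> pverts ?G" "q \<in> pverts ?G" "p \<noteq> q" "a \<in> annihilator R p" "b \<in> annihilator R q"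
        "a \<noteq> \<zero>" "b \<noteq> \<zero>" "a \<otimes> b = \<zero>" for p q a b
      using that unfolding weakly_zero_divisor_graph_def Let_def by auto
    show "(x, y) \<in> parcs ?G \<or> (y, z) \<in> parcs ?G"
    proof (cases "y = x \<or> y = z")
      case True
      then show ?thesis using xz by blast
    next
      case False
      obtain w v where w: "w \<in> annihilator R x" "w \<noteq> \<zero>"
        and v: "v \<in> annihilator R z" "v \<noteq> \<zero>" and wv: "w \<otimes> v = \<zero>"
        using xz by (auto simp: weakly_zero_divisor_graph_def Let_def)
      obtain t where t: "t \<in> carrier R" "t \<noteq> \<zero>" "t \<otimes> y = \<zero>" and y_carr: "y \<in> carrier R"
        using y by (auto simp: weakly_zero_divisor_graph_def Let_def zero_divisors_def m_comm)
      have carr: "w \<in> carrier R" "v \<in> carrier R"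
        using w v by (auto simp: annihilator_def)
      then obtain r where r: "r \<in> carrier R" "r \<otimes> t \<noteq> \<zero>"
        and kill: "w \<otimes> (r \<otimes> t) = \<zero> \<or> v \<otimes> (r \<otimes> t) = \<zero>"
        using nonzero_multiple_annihilated[OF carr t(1) wv t(2)] by blast
      have ann: "r \<otimes> t \<in> annihilator R y"
        using r(1) t y_carr by (simp add: annihilator_def m_assoc)
      from kill show ?thesis
      proof
        assume "w \<otimes> (r \<otimes> t) = \<zero>"
        then have "(x, y) \<in> parcs ?G"
          using arcI[of x y w "r \<otimes> t"] vertices y False w ann r(2) by blast
        then show ?thesis ..
      next
        assume "v \<otimes> (r \<otimes> t) = \<zero>"
        then have "(r \<otimes> t) \<otimes> v = \<zero>"
          using carr r(1) t(1) by (simp add: m_comm)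
        then have "(y, z) \<in> parcs ?G"
          using arcI[of y z "r \<otimes> t" v] vertices y False v ann r(2) by blast
        then show ?thesis ..
      qed
    qed
  qed
qed

theorem theorem4p2:
  fixes R :: "('a, 'm) ring_scheme"
  assumes "artinian_cring R"
    and "pverts (weakly_zero_divisor_graph R) \<noteq> {}"
  shows "vertex_connectivity (weakly_zero_divisor_graph R)
           =o min_degree (weakly_zero_divisor_graph R)"
  using complete_multipartite_graph.vertex_connectivity_ordIso_min_degree
    artinian_cring.complete_multipartite_weakly_zero_divisor_graph assms
  by blast

end
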